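(* Let $V:S\to S$ be a Volterra type operator given by $(Vx)_k=x_k(1+f_k(x))$ for $k\in\mathbb{N}$, $x\in S$, with generating mapping $\mathbf{f}=(f_1,f_2,\dots):S\to\ell_1$. Suppose that $$\sum_{k=1}^\infty x_kf_k(y)+\sum_{k=1}^\infty y_kf_k(x)\le 0\quad\text{for every } x,y\in S.$$ Then $V$ is a bijection of $S$.
   Context: $\mathbb{N}=\{1,2,\dots\}$; $\ell_1$ is the space of real sequences $x=(x_n)$ with $\|x\|_1=\sum_{k}|x_k|<\infty$. The infinite dimensional simplex is $S=\{x\in\ell_1: x_i\ge 0,\ \sum_{n=1}^\infty x_n=1\}$. For $\alpha\subset\mathbb{N}$, the face is $S_\alpha=\{x\in S: x_k=0\ \forall k\in\mathbb{N}\setminus\alpha\}$ and its relative interior is $riS_\alpha=\{x\in S_\alpha: x_k>0\ \forall k\in\alpha\}$. Given a mapping $\mathbf{f}:S\to\ell_1$, $\mathbf{f}(x)=(f_1(x),f_2(x),\dots)$, define $V:S\to\ell_1$ by $(Vx)_k=x_k(1+f_k(x))$, $k\in\mathbb{N}$. The operator $V$ is called a Volterra type operator, and $\mathbf{f}$ its generating mapping, if one of the following two conditions holds: (i) $V$ is continuous in $\ell_1$, $V(S)\subset S$, and $V(riS_\alpha)\subset riS_\alpha$ for every $\alpha\subset\mathbb{N}$; (ii) $\mathbf{f}$ is continuous in the $\ell_1$ topology; $f_k(x)\ge -1$ for all $k\in\mathbb{N}$, $x\in S$; $\sum_{k=1}^\infty x_kf_k(x)=0$ for all $x\in S$; and for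 every $\alpha\subset\mathbb{N}$, $f_k(x)>-1$ for all $x\in riS_\alpha$ and $k\in\alpha$. *)

theory Defs
  imports "HOL-Analysis.Analysis"
begin

text \<open>
  The space of absolutely summable real sequences. Coordinates are indexed by
  \<open>nat = {0, 1, 2, \<dots>}\<close> instead of \<open>{1, 2, \<dots>}\<close>, a mere renaming of the index set.
\<close>

typedef ell1 = "{x :: nat \<Rightarrow> real. summable (\<lambda>k. \<bar>x k\<bar>)}"
  morphisms coord Abs_ell1
  by (rule exI[of _ "\<lambda>_. 0"]) simp

setup_lifting type_definition_ell1

lemma summable_abs_coord: "summable (\<lambda>k. \<bar>coord x k\<bar>)"
  using coord[of x] by simp

lemma ell1_eqI: "(\<And>k. coord x k = coord y k) \<Longrightarrow> x = y"
  by (simp add: coord_inject[symmetric] fun_eq_iff)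

lemma summable_abs_add:
  fixes a b :: "nat \<Rightarrow> real"
  assumes "summable (\<lambda>k. \<bar>a k\<bar>)" "summable (\<lambda>k. \<bar>b k\<bar>)"
  shows "summable (\<lambda>k. \<bar>a k + b k\<bar>)"
  by (rule summable_comparison_test'[OF summable_add[OF assms], where N = 0]) auto

instantiation ell1 :: real_vector
begin

lift_definition zero_ell1 :: ell1 is "\<lambda>_. 0" by simp

lift_definition plus_ell1 :: "ell1 \<Rightarrow> ell1 \<Rightarrow> ell1" is "\<lambda>x y k. x k + y k"
  by (rule summable_abs_add)

lift_definition uminus_ell1 :: "ell1 \<Rightarrow> ell1" is "\<lambda>x k. - x k" by simp

lift_definition minus_ell1 :: "ell1 \<Rightarrow> ell1 \<Rightarrow> ell1" is "\<lambda>x y k. x k - y k"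
  subgoal for x y using summable_abs_add[of x "\<lambda>k. - y k"] by simp
  done

lift_definition scaleR_ell1 :: "real \<Rightarrow> ell1 \<Rightarrow> ell1" is "\<lambda>c x k. c * x k"
  by (simp add: abs_mult summable_mult)

instance
  by standard (transfer; simp add: fun_eq_iff algebra_simps)+

end

instantiation ell1 :: real_normed_vector
begin

lift_definition norm_ell1 :: "ell1 \<Rightarrow> real" is "\<lambda>x. \<Sum>k. \<bar>x k\<bar>" .

definition sgn_ell1 :: "ell1 \<Rightarrow> ell1" where
  "sgn_ell1 x = x /\<^sub>R norm x"

definition dist_ell1 :: "ell1 \<Rightarrow> ell1 \<Rightarrow> real" where
  "dist_ell1 x y = norm (x - y)"

definition uniformity_ell1 :: "(ell1 \<times> ell1) filter" where
  "uniformity_ell1 = (INF e\<in>{0<..}. principal {(x, y). dist x y < e})"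

definition open_ell1 :: "ell1 set \<Rightarrow> bool" where
  "open_ell1 U \<longleftrightarrow> (\<forall>x\<in>U. \<forall>\<^sub>F (x', y) in uniformity. x' = x \<longrightarrow> y \<in> U)"

instance
proof
  fix x y :: ell1 and c :: real
  show "norm x = 0 \<longleftrightarrow> x = 0"
    by transfer (simp add: suminf_eq_zero_iff fun_eq_iff)
  show "norm (x + y) \<le> norm x + norm y"
  proof transfer
    fix x y :: "nat \<Rightarrow> real"
    assume *: "summable (\<lambda>k. \<bar>x k\<bar>)" "summable (\<lambda>k. \<bar>y k\<bar>)"
    have "(\<Sum>k. \<bar>x k + y k\<bar>) \<le> (\<Sum>k. \<bar>x k\<bar> + \<bar>y k\<bar>)"
      by (rule suminf_le[OF _ summable_abs_add[OF *] summable_add[OF *]]) simp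
    also have "\<dots> = (\<Sum>k. \<bar>x k\<bar>) + (\<Sum>k. \<bar>y k\<bar>)"
      using * by (simp add: suminf_add)
    finally show "(\<Sum>k. \<bar>x k + y k\<bar>) \<le> (\<Sum>k. \<bar>x k\<bar>) + (\<Sum>k. \<bar>y k\<bar>)" .
  qed
  show "norm (c *\<^sub>R x) = \<bar>c\<bar> * norm x"
    by transfer (simp add: abs_mult suminf_mult)
qed (simp_all add: sgn_ell1_def dist_ell1_def uniformity_ell1_def open_ell1_def)

end

lemma norm_ell1: "norm x = (\<Sum>k. \<bar>coord x k\<bar>)"
  by transfer simp

definition simplex_ell1 :: "ell1 set" where
  "simplex_ell1 = {x. (\<forall>k. coord x k \<ge> 0) \<and> (\<Sum>k. coord x k) = 1}"

definition face :: "nat set \<Rightarrow> ell1 set" where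
  "face \<alpha> = {x \<in> simplex_ell1. \<forall>k. k \<notin> \<alpha> \<longrightarrow> coord x k = 0}"

definition ri_face :: "nat set \<Rightarrow> ell1 set" where
  "ri_face \<alpha> = {x \<in> face \<alpha>. \<forall>k\<in>\<alpha>. coord x k > 0}"

text \<open>
  Only the values of \<open>V\<close> and \<open>f\<close> on the simplex matter below. All series converge absolutely,
  since members of \<^typ>\<open>ell1\<close> are bounded.
\<close>

definition volterra_form :: "(ell1 \<Rightarrow> ell1) \<Rightarrow> (ell1 \<Rightarrow> ell1) \<Rightarrow> bool" where
  "volterra_form V f \<longleftrightarrow>
     (\<forall>x\<in>simplex_ell1. \<forall>k. coord (V x) k = coord x k * (1 + coord (f x) k))"

definition volterra_cond_i :: "(ell1 \<Rightarrow> ell1) \<Rightarrow> bool" where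
  "volterra_cond_i V \<longleftrightarrow>
     continuous_on simplex_ell1 V \<and>
     V ` simplex_ell1 \<subseteq> simplex_ell1 \<and>
     (\<forall>\<alpha>. V ` ri_face \<alpha> \<subseteq> ri_face \<alpha>)"

definition volterra_cond_ii :: "(ell1 \<Rightarrow> ell1) \<Rightarrow> bool" where
  "volterra_cond_ii f \<longleftrightarrow>
     continuous_on simplex_ell1 f \<and>
     (\<forall>x\<in>simplex_ell1. \<forall>k. coord (f x) k \<ge> -1) \<and>
     (\<forall>x\<in>simplex_ell1. (\<Sum>k. coord x k * coord (f x) k) = 0) \<and>
     (\<forall>\<alpha>. \<forall>x\<in>ri_face \<alpha>. \<forall>k\<in>\<alpha>. coord (f x) k > -1)"

definition volterra_type :: "(ell1 \<Rightarrow> ell1) \<Rightarrow> (ell1 \<Rightarrow> ell1) \<Rightarrow> bool" where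
  "volterra_type V f \<longleftrightarrow> volterra_form V f \<and> (volterra_cond_i V \<or> volterra_cond_ii f)"

end

theory Submission
  imports Defs
begin

text \<open>
  Write \<open>u = 1 + f(x)\<close> and \<open>v = 1 + f(y)\<close>, so that \<open>V x = x u\<close> and \<open>V y = y v\<close> coordinatewise.
  Since \<open>V\<close> preserves the simplex, \<open>\<Sum> x\<^sub>k f\<^sub>k(x) = 0\<close>, and the hypothesis turns into the monotonicity
  \<open>\<Sum> (x\<^sub>k - y\<^sub>k)(f\<^sub>k(x) - f\<^sub>k(y)) \<ge> 0\<close>. The identity
  \[ \frac{(a - b)^2 (u + v)}{a + b} + (a - b)(u - v) = \frac{2 (a - b)(a u - b v)}{a + b} \]
  then gives, for points with the same support, the stability estimate (\<open>gap_sum_le\<close>)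
  \[ \sum_k \frac{(x_k - y_k)^2 (u_k + v_k)}{x_k + y_k} \le 2 \| V x - V y \|. \]

  Injectivity is immediate: \<open>V x = V y\<close> forces equal supports, because \<open>V\<close> preserves the relative
  interior of each face; on the common support \<open>u + v > 0\<close>, hence \<open>x = y\<close>.

  For surjectivity the difficulty is that the simplex is not compact. On a face with finitely many
  vertices \<open>V\<close> is onto by a Brouwer argument (\<open>surj_on_finite_face\<close>). Such faces are dense, and
  a small perturbation keeps the image close, so every \<open>y\<close> is a limit of \<open>V x\<^sup>m\<close> where all
  coordinates of \<open>x\<^sup>m\<close> are positive (\<open>V_ri_dense\<close>). Compactness comes back from the stability
  estimate: fix one such point \<open>b = x\<^sup>N\<close>. As \<open>f(b)\<close> is summable, \<open>v\<^sub>k = 1 + f\<^sub>k(b) \<ge> 1/2\<close> for all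
  large \<open>k\<close>, so the estimate controls the tail of \<open>x\<^sup>m - b\<close> by \<open>\<parallel>V x\<^sup>m - V b\<parallel>\<close>
  (\<open>tail_diff_le\<close>), which is small for \<open>m \<ge> N\<close> and large \<open>N\<close>. Thus the tails of the \<open>x\<^sup>m\<close> are
  uniformly small, a subsequence converges in norm, and by continuity its limit is mapped to \<open>y\<close>.
  Positivity of all coordinates matters here: condition (i) leaves \<open>f\<^sub>k\<close> uncontrolled
  from below at points where \<open>x\<^sub>k = 0\<close>.
\<close>

section \<open>Coordinates and the simplex\<close>

lemmas coord_simps [simp] =
  zero_ell1.rep_eq plus_ell1.rep_eq uminus_ell1.rep_eq minus_ell1.rep_eq scaleR_ell1.rep_eq

lemma summable_coord: "summable (coord x)"
  using summable_rabs_cancel[OF summable_abs_coord[of x]] by simp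

lemma abs_coord_le_norm: "\<bar>coord x k\<bar> \<le> norm x"
proof -
  have "(\<Sum>i\<in>{k}. \<bar>coord x i\<bar>) \<le> (\<Sum>i. \<bar>coord x i\<bar>)"
    by (rule sum_le_suminf[OF summable_abs_coord]) auto
  then show ?thesis by (simp add: norm_ell1)
qed

lemma bounded_linear_coord: "bounded_linear (\<lambda>x. coord x k)"
  by (rule bounded_linear_intro[where K = 1]) (use abs_coord_le_norm in auto)

lemmas tendsto_coord [tendsto_intros] = bounded_linear.tendsto[OF bounded_linear_coord]

lemma norm_eq_suminf_coord:
  assumes "\<And>k. 0 \<le> coord x k"
  shows "norm x = (\<Sum>k. coord x k)"
  using assms by (simp add: norm_ell1)

text \<open>
  On the positive cone the norm is additive. This is what makes the simplex convex, and it lets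
  an inequality between positive vectors of equal norm be upgraded to an equality.
\<close>

lemma norm_add_nonneg:
  assumes "\<And>k. 0 \<le> coord x k" "\<And>k. 0 \<le> coord y k"
  shows "norm (x + y) = norm x + norm y"
  using assms by (simp add: norm_eq_suminf_coord suminf_add[OF summable_coord summable_coord])

lemma simplex_ell1_iff: "x \<in> simplex_ell1 \<longleftrightarrow> (\<forall>k. 0 \<le> coord x k) \<and> norm x = 1"
  by (auto simp: simplex_ell1_def norm_eq_suminf_coord)

lemma convex_simplex_ell1: "convex simplex_ell1"
  unfolding convex_def by (auto simp: simplex_ell1_iff norm_add_nonneg)

lemma closed_simplex_ell1: "closed simplex_ell1"
  unfolding closed_sequential_limits
proof (intro allI impI)
  fix x l assume "(\<forall>n. x n \<in> simplex_ell1) \<and> x \<longlonglongrightarrow> l"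
  then have x: "\<And>n k. 0 \<le> coord (x n) k" "\<And>n. norm (x n) = 1" and l: "x \<longlonglongrightarrow> l"
    by (auto simp: simplex_ell1_iff)
  have "0 \<le> coord l k" for k
    using x(1) by (intro LIMSEQ_le_const[OF tendsto_coord[OF l]]) auto
  moreover have "norm l = 1"
    using LIMSEQ_unique[OF tendsto_norm[OF l]] x(2) by simp
  ultimately show "l \<in> simplex_ell1" by (simp add: simplex_ell1_iff)
qed

text \<open>
  The coordinatewise product turns \<open>V x\<close> into \<open>x + pmult x (f x)\<close>; its boundedness as a bilinear
  map yields both the continuity of \<open>V\<close> from that of \<open>f\<close> and the convergence of all pairings.
\<close>

lift_definition pmult :: "ell1 \<Rightarrow> ell1 \<Rightarrow> ell1" is "\<lambda>x y k. x k * y k"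
proof -
  fix x y :: "nat \<Rightarrow> real"
  assume x: "summable (\<lambda>k. \<bar>x k\<bar>)" and y: "summable (\<lambda>k. \<bar>y k\<bar>)"
  have "\<bar>y k\<bar> \<le> (\<Sum>k. \<bar>y k\<bar>)" for k
    using sum_le_suminf[OF y, of "{k}"] by auto
  then show "summable (\<lambda>k. \<bar>x k * y k\<bar>)"
    by (intro summable_comparison_test'[OF summable_mult2[OF x, of "\<Sum>k. \<bar>y k\<bar>"], where N = 0])
      (auto simp: abs_mult mult_left_mono)
qed

lemmas coord_pmult [simp] = pmult.rep_eq

lemma bounded_bilinear_pmult: "bounded_bilinear pmult"
proof (unfold_locales, goal_cases)
  case 5
  have "norm (pmult x y) \<le> norm x * norm y * 1" for x y
  proof -
    have "norm (pmult x y) \<le> (\<Sum>k. \<bar>coord x k\<bar> * norm y)"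
      unfolding norm_ell1[of "pmult x y"]
      by (intro suminf_le summable_abs_coord summable_mult2)
        (auto simp: abs_mult intro!: mult_left_mono abs_coord_le_norm)
    also have "\<dots> = norm x * norm y"
      by (simp add: norm_ell1[of x] suminf_mult2[OF summable_abs_coord])
    finally show ?thesis by simp
  qed
  then show ?case by blast
qed (rule ell1_eqI; simp add: algebra_simps)+

lemma summable_coord_mult: "summable (\<lambda>k. coord x k * coord y k)"
  using summable_coord[of "pmult x y"] by simp

section \<open>Tails and relative compactness\<close>

definition tail :: "ell1 \<Rightarrow> nat \<Rightarrow> real" where
  "tail x K = (\<Sum>k. \<bar>coord x (k + K)\<bar>)"

lemma norm_eq_sum_tail: "norm x = (\<Sum>k<K. \<bar>coord x k\<bar>) + tail x K"
  unfolding norm_ell1 tail_def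
  using suminf_split_initial_segment[OF summable_abs_coord, of x K] by simp

lemma summable_tail: "summable (\<lambda>k. \<bar>coord x (k + K)\<bar>)"
  using summable_ignore_initial_segment[OF summable_abs_coord] .

lemma tail_nonneg: "0 \<le> tail x K"
  unfolding tail_def by (rule suminf_nonneg[OF summable_tail]) simp

lemma tail_antimono: "K \<le> L \<Longrightarrow> tail x L \<le> tail x K"
  using norm_eq_sum_tail[of x K] norm_eq_sum_tail[of x L]
    sum_mono2[of "{..<L}" "{..<K}" "\<lambda>k. \<bar>coord x k\<bar>"] by auto

lemma tail_triangle: "tail (x + y) K \<le> tail x K + tail y K"
  unfolding tail_def suminf_add[OF summable_tail summable_tail]
  by (intro suminf_le summable_add summable_tail) (simp add: summable_tail[of "x + y", simplified] abs_triangle_ineq)+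

lemma tail_minus: "tail (- x) K = tail x K"
  by (simp add: tail_def)

lemma tail_tendsto_0: "tail x \<longlonglongrightarrow> 0"
proof -
  have "(\<lambda>K. norm x - (\<Sum>k<K. \<bar>coord x k\<bar>)) \<longlonglongrightarrow> norm x - norm x"
    unfolding norm_ell1
    by (intro tendsto_diff tendsto_const summable_LIMSEQ summable_abs_coord)
  moreover have "tail x = (\<lambda>K. norm x - (\<Sum>k<K. \<bar>coord x k\<bar>))"
    using norm_eq_sum_tail[of x] by (simp add: fun_eq_iff eq_diff_eq add.commute)
  ultimately show ?thesis by simp
qed

lemma tendsto_if_coordwise_tight:
  assumes coordwise: "\<And>k. (\<lambda>m. coord (x m) k) \<longlonglongrightarrow> coord l k"
    and tight: "\<And>e. e > 0 \<Longrightarrow> \<exists>K. \<forall>\<^sub>F m in sequentially. tail (x m) K \<le> e"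
  shows "x \<longlonglongrightarrow> l"
proof (rule tendstoI)
  fix e :: real assume "e > 0"
  then have e: "e / 4 > 0" by simp
  obtain K where K: "\<forall>\<^sub>F m in sequentially. tail (x m) K \<le> e / 4"
    using tight[OF e] by blast
  obtain L0 where "\<And>L. L \<ge> L0 \<Longrightarrow> tail l L < e / 4"
    using order_tendstoD(2)[OF tail_tendsto_0 e, of l] unfolding eventually_sequentially by blast
  then obtain L where L: "L \<ge> K" "tail l L < e / 4"
    by (meson max.cobounded1 max.cobounded2)
  have "(\<lambda>m. \<Sum>k<L. \<bar>coord (x m) k - coord l k\<bar>) \<longlonglongrightarrow> (\<Sum>k<L. \<bar>coord l k - coord l k\<bar>)"
    by (intro tendsto_intros coordwise)
  then have "\<forall>\<^sub>F m in sequentially. (\<Sum>k<L. \<bar>coord (x m) k - coord l k\<bar>) < e / 4"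
    using e by (intro order_tendstoD(2)) auto
  with K show "\<forall>\<^sub>F m in sequentially. dist (x m) l < e"
  proof eventually_elim
    case (elim m)
    have "dist (x m) l = (\<Sum>k<L. \<bar>coord (x m) k - coord l k\<bar>) + tail (x m - l) L"
      by (simp add: dist_norm norm_eq_sum_tail[of "x m - l" L])
    also have "tail (x m - l) L \<le> tail (x m) L + tail l L"
      using tail_triangle[of "x m" "- l" L] by (simp add: tail_minus)
    also have "tail (x m) L \<le> tail (x m) K"
      using L by (intro tail_antimono)
    finally show ?case using elim L e by linarith
  qed
qed

text \<open>
  A coordinatewise convergent subsequence exists by Tychonoff, its limit is summable because the
  partial sums inherit the norm bound, and tightness upgrades the convergence to norm convergence.
\<close>

lemma tight_imp_convergent_subseq:
  assumes bounded: "\<And>m. norm (x m) \<le> B"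
    and tight: "\<And>e. e > 0 \<Longrightarrow> \<exists>K. \<forall>\<^sub>F m in sequentially. tail (x m) K \<le> e"
  obtains l r where "strict_mono r" "(x \<circ> r) \<longlonglongrightarrow> l"
proof -
  have "compact (PiE UNIV (\<lambda>_::nat. {-B..B}))"
    using compactin_PiE[of "\<lambda>_::nat. euclidean :: real topology" UNIV "\<lambda>_. {-B..B}"]
    by (simp add: euclidean_product_topology)
  then have "seq_compact (PiE UNIV (\<lambda>_::nat. {-B..B}))"
    by (rule compact_imp_seq_compact)
  moreover have "\<forall>m. coord (x m) \<in> PiE UNIV (\<lambda>_::nat. {-B..B})"
    using order_trans[OF abs_coord_le_norm bounded] by (simp add: abs_le_iff PiE_iff minus_le_iff)
  ultimately obtain g r where r: "strict_mono (r :: nat \<Rightarrow> nat)"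
    and g: "((\<lambda>m. coord (x m)) \<circ> r) \<longlonglongrightarrow> g"
    unfolding seq_compact_def by meson
  have coordwise: "(\<lambda>m. coord (x (r m)) k) \<longlonglongrightarrow> g k" for k
    using continuous_on_tendsto_compose[OF continuous_on_product_coordinates g, of k] by (simp add: o_def)
  have "(\<Sum>k<N. \<bar>g k\<bar>) \<le> B" for N
  proof (rule LIMSEQ_le_const2)
    show "(\<lambda>m. \<Sum>k<N. \<bar>coord (x (r m)) k\<bar>) \<longlonglongrightarrow> (\<Sum>k<N. \<bar>g k\<bar>)"
      by (intro tendsto_intros coordwise)
    have "(\<Sum>k<N. \<bar>coord (x (r m)) k\<bar>) \<le> B" for m
      using norm_eq_sum_tail[of "x (r m)" N] tail_nonneg[of "x (r m)" N] bounded[of "r m"] by simp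
    then show "\<exists>M. \<forall>m\<ge>M. (\<Sum>k<N. \<bar>coord (x (r m)) k\<bar>) \<le> B" by blast
  qed
  then have "summable (\<lambda>k. \<bar>g k\<bar>)"
    by (intro summableI_nonneg_bounded[where x = B]) auto
  then have "coord (Abs_ell1 g) = g" by (simp add: Abs_ell1_inverse)
  then have "(x \<circ> r) \<longlonglongrightarrow> Abs_ell1 g"
    using coordwise eventually_subseq[OF r] tight
    by (intro tendsto_if_coordwise_tight) (simp_all, meson)
  with r show thesis by (rule that)
qed

section \<open>Complementarity on a finite-dimensional box\<close>

definition finvec :: "nat \<Rightarrow> (nat \<Rightarrow> real) \<Rightarrow> ell1" where
  "finvec n g = Abs_ell1 (\<lambda>k. if k < n then g k else 0)"

lemma coord_finvec [simp]: "coord (finvec n g) k = (if k < n then g k else 0)"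
proof -
  have "summable (\<lambda>k. \<bar>if k < n then g k else 0\<bar>)"
    by (rule summable_finite[of "{..<n}"]) auto
  then show ?thesis by (simp add: finvec_def Abs_ell1_inverse)
qed

lemma norm_if_finite_support:
  assumes "\<And>k. k \<ge> n \<Longrightarrow> coord x k = 0"
  shows "norm x = (\<Sum>k<n. \<bar>coord x k\<bar>)"
  using assms by (simp add: norm_eq_sum_tail[of x n] tail_def)

definition unit_box :: "nat \<Rightarrow> ell1 set" where
  "unit_box n = {c. \<forall>k. 0 \<le> coord c k \<and> coord c k \<le> 1 \<and> (n \<le> k \<longrightarrow> coord c k = 0)}"

text \<open>
  This is the form of Brouwer's theorem used below: the variational inequality on a box. The proof
  applies Kuhn's combinatorial lemma to finer and finer grids. A grid point gets label \<open>0\<close> in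
  direction \<open>i\<close> if it lies on the lower face or if \<open>F\<^sub>i\<close> is nonnegative there, and label \<open>1\<close>
  otherwise. Some grid cell shows both labels in every direction; shrinking cells accumulate at a
  point \<open>c\<close>, where continuity turns the labels into the two sign conditions.
  Kuhn's lemma is stated for a dimension that is a number rather than a type, which is
  what the later passage to the limit over all finite faces requires.
\<close>

lemma unit_box_complementarity:
  assumes F: "continuous_on (unit_box n) F"
  obtains c where "c \<in> unit_box n"
    and "\<And>i. i < n \<Longrightarrow> 0 < coord c i \<Longrightarrow> 0 \<le> coord (F c) i"
    and "\<And>i. i < n \<Longrightarrow> coord c i < 1 \<Longrightarrow> coord (F c) i \<le> 0"
proof -
  define grid where "grid m x = finvec n (\<lambda>i. real (x i) / real (Suc m))" for m and x :: "nat \<Rightarrow> nat"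
  have coord_grid: "coord (grid m x) i = (if i < n then real (x i) / real (Suc m) else 0)" for m x i
    by (simp add: grid_def)
  have grid_box: "grid m x \<in> unit_box n" if "\<And>i. i < n \<Longrightarrow> x i \<le> Suc m" for m x
    using that by (simp add: unit_box_def coord_grid del: of_nat_Suc)
  define cell where "cell q x \<longleftrightarrow> (\<forall>j<n. q j \<le> x j \<and> x j \<le> q j + 1)" for q x :: "nat \<Rightarrow> nat"
  define good where "good m q r s \<longleftrightarrow> (\<forall>i<n. q i < Suc m \<and> cell q (r i) \<and> cell q (s i) \<and>
      (r i i = 0 \<or> 0 \<le> coord (F (grid m (r i))) i) \<and>
      (s i i = Suc m \<or> coord (F (grid m (s i))) i \<le> 0))" for m q r s
  have "\<exists>q r s. good m q r s" for m
  proof -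
    \<comment> \<open>The upper face must carry label \<open>1\<close>, so the sign of \<open>F\<^sub>i\<close> is consulted only away from it.\<close>
    define label where "label x i =
      (if x i = 0 \<or> x i \<noteq> Suc m \<and> 0 \<le> coord (F (grid m x)) i then 0 else 1 :: nat)" for x i
    obtain q where q: "\<forall>i<n. q i < Suc m"
      and lab: "\<forall>i<n. \<exists>r s. (\<forall>j<n. q j \<le> r j \<and> r j \<le> q j + 1) \<and>
        (\<forall>j<n. q j \<le> s j \<and> s j \<le> q j + 1) \<and> label r i \<noteq> label s i"
      by (rule kuhn_lemma[of "Suc m" n label]) (simp_all add: label_def)
    have lab0: "x i = 0 \<or> 0 \<le> coord (F (grid m x)) i" if "label x i = 0" for x i
      using that by (auto simp: label_def split: if_splits)
    have lab1: "x i = Suc m \<or> coord (F (grid m x)) i \<le> 0" if "label x i \<noteq> 0" for x i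
      using that by (auto simp: label_def split: if_splits)
    have "\<exists>r s. cell q r \<and> cell q s \<and> label r i = 0 \<and> label s i \<noteq> 0" if "i < n" for i
    proof -
      obtain r s where rs: "cell q r" "cell q s" "label r i \<noteq> label s i"
        using lab \<open>i < n\<close> unfolding cell_def by blast
      show ?thesis
      proof (cases "label r i = 0")
        case True with rs show ?thesis by auto
      next
        case False
        then have "label s i = 0" using rs(3) by (simp add: label_def split: if_splits)
        with False rs show ?thesis by blast
      qed
    qed
    then obtain r s where "\<And>i. i < n \<Longrightarrow> cell q (r i) \<and> cell q (s i) \<and> label (r i) i = 0 \<and> label (s i) i \<noteq> 0"
      by metis
    with q lab0 lab1 have "good m q r s" unfolding good_def by simp
    then show ?thesis by blast
  qed
  then obtain q r s where "\<And>m. good m (q m) (r m) (s m)"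
    by metis
  then have q: "\<And>m i. i < n \<Longrightarrow> q m i < Suc m"
    and r: "\<And>m i j. i < n \<Longrightarrow> j < n \<Longrightarrow> q m j \<le> r m i j \<and> r m i j \<le> q m j + 1"
    and s: "\<And>m i j. i < n \<Longrightarrow> j < n \<Longrightarrow> q m j \<le> s m i j \<and> s m i j \<le> q m j + 1"
    and r0: "\<And>m i. i < n \<Longrightarrow> r m i i = 0 \<or> 0 \<le> coord (F (grid m (r m i))) i"
    and s1: "\<And>m i. i < n \<Longrightarrow> s m i i = Suc m \<or> coord (F (grid m (s m i))) i \<le> 0"
    unfolding good_def cell_def by blast+
  have near: "(\<lambda>m. grid m (t m) - grid m (q m)) \<longlonglongrightarrow> 0"
    if t: "\<And>m j. j < n \<Longrightarrow> q m j \<le> t m j \<and> t m j \<le> q m j + 1" for t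
  proof (rule Lim_null_comparison)
    have "norm (grid m (t m) - grid m (q m)) \<le> real n * inverse (real (Suc m))" for m
    proof -
      have "norm (grid m (t m) - grid m (q m)) = (\<Sum>k<n. \<bar>real (t m k) - real (q m k)\<bar> / real (Suc m))"
        by (subst norm_if_finite_support[of n])
          (auto simp: coord_grid diff_divide_distrib[symmetric] simp del: of_nat_Suc)
      also have "\<dots> \<le> (\<Sum>k<n. 1 / real (Suc m))"
        by (intro sum_mono divide_right_mono) (use t[of _ m] in \<open>force simp: abs_le_iff\<close>, simp)
      finally show ?thesis by (simp add: field_simps)
    qed
    then show "\<forall>\<^sub>F m in sequentially. norm (grid m (t m) - grid m (q m)) \<le> real n * inverse (real (Suc m))"
      by simp
    show "(\<lambda>m. real n * inverse (real (Suc m))) \<longlonglongrightarrow> 0"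
      using tendsto_mult_right_zero[OF LIMSEQ_inverse_real_of_nat] .
  qed
  have norm_grid: "norm (grid m (q m)) \<le> real n" for m
  proof -
    have "norm (grid m (q m)) = (\<Sum>k<n. \<bar>coord (grid m (q m)) k\<bar>)"
      by (rule norm_if_finite_support) (simp add: coord_grid)
    also have "\<dots> \<le> (\<Sum>k<n. 1)"
      using grid_box[of "q m" m] q[of _ m] by (intro sum_mono) (auto simp: unit_box_def less_imp_le)
    finally show ?thesis by simp
  qed
  have "tail (grid m (q m)) n = 0" for m
    by (simp add: tail_def coord_grid)
  then have "\<exists>K. \<forall>\<^sub>F m in sequentially. tail (grid m (q m)) K \<le> e" if "e > 0" for e
    using that by (intro exI[of _ n]) simp
  then obtain c \<phi> where \<phi>: "strict_mono \<phi>" and c: "((\<lambda>m. grid m (q m)) \<circ> \<phi>) \<longlonglongrightarrow> c"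
    using tight_imp_convergent_subseq[of "\<lambda>m. grid m (q m)" "real n"] norm_grid by blast
  have lim: "(\<lambda>m. grid (\<phi> m) (t (\<phi> m))) \<longlonglongrightarrow> c"
    if t: "\<And>m j. j < n \<Longrightarrow> q m j \<le> t m j \<and> t m j \<le> q m j + 1" for t
    using tendsto_add[OF LIMSEQ_subseq_LIMSEQ[OF near[OF t] \<phi>] c] by (simp add: o_def)
  have limc: "(\<lambda>m. grid (\<phi> m) (q (\<phi> m))) \<longlonglongrightarrow> c" using c by (simp add: o_def)
  have q_box: "grid m (q m) \<in> unit_box n" for m
    using q by (intro grid_box) (simp add: less_imp_le)
  have t_box: "grid m (t m) \<in> unit_box n"
    if t: "\<And>m j. j < n \<Longrightarrow> q m j \<le> t m j \<and> t m j \<le> q m j + 1" for t m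
  proof (rule grid_box)
    fix i assume "i < n" then show "t m i \<le> Suc m" using q[of i m] t[of i m] by linarith
  qed
  have c_box: "c \<in> unit_box n"
  proof -
    have "0 \<le> coord c k" "coord c k \<le> 1" "n \<le> k \<Longrightarrow> coord c k = 0" for k
      using q_box by (auto simp: unit_box_def intro: LIMSEQ_le_const[OF tendsto_coord[OF limc]]
          LIMSEQ_le_const2[OF tendsto_coord[OF limc]] LIMSEQ_unique[OF tendsto_coord[OF limc]])
    then show ?thesis by (simp add: unit_box_def)
  qed
  have Flim: "(\<lambda>m. coord (F (grid (\<phi> m) (t (\<phi> m)))) i) \<longlonglongrightarrow> coord (F c) i"
    if t: "\<And>m j. j < n \<Longrightarrow> q m j \<le> t m j \<and> t m j \<le> q m j + 1" for t i
    using t_box[OF t] c_box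
    by (intro tendsto_coord continuous_on_tendsto_compose[OF F lim[OF t]]) auto
  show thesis
  proof (rule that[OF c_box])
    fix i assume i: "i < n" and pos: "0 < coord c i"
    have "\<forall>\<^sub>F m in sequentially. 0 < coord (grid (\<phi> m) (r (\<phi> m) i)) i"
      using order_tendstoD(1)[OF tendsto_coord[OF lim[of "\<lambda>m. r m i"]] pos] r[OF i] by simp
    then have "\<forall>\<^sub>F m in sequentially. 0 \<le> coord (F (grid (\<phi> m) (r (\<phi> m) i))) i"
      by eventually_elim (use r0[OF i] i in \<open>force simp: coord_grid\<close>)
    then show "0 \<le> coord (F c) i"
      using tendsto_lowerbound[OF Flim[of "\<lambda>m. r m i"]] r[OF i] by simp
  next
    fix i assume i: "i < n" and less: "coord c i < 1"
    have "\<forall>\<^sub>F m in sequentially. coord (grid (\<phi> m) (s (\<phi> m) i)) i < 1"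
      using order_tendstoD(2)[OF tendsto_coord[OF lim[of "\<lambda>m. s m i"]] less] s[OF i] by simp
    then have "\<forall>\<^sub>F m in sequentially. coord (F (grid (\<phi> m) (s (\<phi> m) i))) i \<le> 0"
      by eventually_elim (use s1[OF i] i in \<open>force simp: coord_grid simp del: of_nat_Suc\<close>)
    then show "coord (F c) i \<le> 0"
      using tendsto_upperbound[OF Flim[of "\<lambda>m. s m i"]] s[OF i] by simp
  qed
qed

section \<open>Surjectivity on finite faces and density\<close>

text \<open>
  The positively homogeneous extension of \<open>V\<close> to the positive cone. At the origin, where \<open>V\<close> is
  evaluated at \<open>0 / 0 = 0\<close> outside the simplex, continuity holds because \<open>V\<close> has norm one on the simplex and
  so the extension preserves the norm.
\<close>

lemma continuous_on_cone_extension: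
  assumes V: "continuous_on simplex_ell1 V" "V ` simplex_ell1 \<subseteq> simplex_ell1"
  shows "continuous_on {c. \<forall>k. 0 \<le> coord c k} (\<lambda>c. norm c *\<^sub>R V (c /\<^sub>R norm c))"
    (is "continuous_on ?P ?W")
  unfolding continuous_on_def
proof
  have normalized: "c /\<^sub>R norm c \<in> simplex_ell1" if "c \<in> ?P" "c \<noteq> 0" for c
    using that by (simp add: simplex_ell1_iff)
  fix c assume c: "c \<in> ?P"
  show "(?W \<longlongrightarrow> ?W c) (at c within ?P)"
  proof (cases "c = 0")
    case True
    have "norm (?W z) \<le> norm z" if "z \<in> ?P" for z
    proof (cases "z = 0")
      case False
      then have "V (z /\<^sub>R norm z) \<in> simplex_ell1"
        using normalized[OF that] V(2) by blast
      then show ?thesis by (simp add: simplex_ell1_iff)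
    qed simp
    then have "\<forall>\<^sub>F z in at 0 within ?P. norm (?W z) \<le> norm z"
      unfolding eventually_at_filter by simp
    moreover have "((\<lambda>z::ell1. norm z) \<longlongrightarrow> 0) (at 0 within ?P)"
      by (intro tendsto_norm_zero tendsto_ident_at)
    ultimately have "(?W \<longlongrightarrow> 0) (at 0 within ?P)"
      by (rule Lim_null_comparison)
    with True show ?thesis by simp
  next
    case False
    have "continuous_on (?P - {0}) ?W"
      using normalized
      by (intro continuous_intros continuous_on_compose2[OF V(1)]) auto
    then have "(?W \<longlongrightarrow> ?W c) (at c within (?P - {0}))"
      using c False by (simp add: continuous_on_def)
    also have "at c within (?P - {0}) = at c within ?P"
      using False by (intro at_within_nhd[of c "- {0}"]) auto
    finally show ?thesis .
  qed
qed

text \<open>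
  Let \<open>W\<close> be the homogeneous extension of \<open>V\<close> and apply complementarity to \<open>y - W\<close>. At the
  resulting point \<open>c\<close> one has \<open>W c \<le> y\<close>: where \<open>c\<^sub>i > 0\<close> by complementarity, and where \<open>c\<^sub>i = 0\<close>
  because \<open>W c\<close> vanishes there too. If all \<open>c\<^sub>i < 1\<close>, the reverse inequality holds as well.
  Otherwise \<open>\<parallel>W c\<parallel> = \<parallel>c\<parallel> \<ge> 1 = \<parallel>y\<parallel>\<close>, and \<open>0 \<le> W c \<le> y\<close> leaves no room for a strict inequality.
  Either way \<open>W c = y\<close>, so \<open>\<parallel>c\<parallel> = 1\<close> and \<open>W c\<close> is \<open>V c\<close>.
\<close>

lemma surj_on_finite_face:
  assumes V: "continuous_on simplex_ell1 V" "V ` simplex_ell1 \<subseteq> simplex_ell1"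
    and zero: "\<And>x k. x \<in> simplex_ell1 \<Longrightarrow> coord x k = 0 \<Longrightarrow> coord (V x) k = 0"
    and y: "y \<in> face {..<n}"
  obtains x where "x \<in> face {..<n}" "V x = y"
proof -
  define W where "W c = norm c *\<^sub>R V (c /\<^sub>R norm c)" for c
  have "unit_box n \<subseteq> {c. \<forall>k. 0 \<le> coord c k}"
    by (auto simp: unit_box_def)
  then have "continuous_on (unit_box n) (\<lambda>c. y - W c)"
    unfolding W_def
    by (intro continuous_on_diff continuous_on_const
        continuous_on_subset[OF continuous_on_cone_extension[OF V]])
  then obtain c where c: "c \<in> unit_box n"
    and pos: "\<And>i. i < n \<Longrightarrow> 0 < coord c i \<Longrightarrow> 0 \<le> coord (y - W c) i"
    and less: "\<And>i. i < n \<Longrightarrow> coord c i < 1 \<Longrightarrow> coord (y - W c) i \<le> 0"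
    by (rule unit_box_complementarity) blast
  have y0: "coord y k = 0" if "n \<le> k" for k
    using y that by (simp add: face_def)
  have ynonneg: "0 \<le> coord y k" and ynorm: "norm y = 1" for k
    using y by (auto simp: face_def simplex_ell1_iff)
  have cnonneg: "0 \<le> coord c k" for k
    using c by (simp add: unit_box_def)
  have c0: "coord c k = 0" if "n \<le> k" for k
    using c that by (simp add: unit_box_def)
  have "(\<forall>k. 0 \<le> coord (W c) k \<and> (coord c k = 0 \<longrightarrow> coord (W c) k = 0)) \<and> norm (W c) = norm c"
  proof (cases "c = 0")
    case False
    then have *: "c /\<^sub>R norm c \<in> simplex_ell1"
      using cnonneg by (simp add: simplex_ell1_iff)
    then have "V (c /\<^sub>R norm c) \<in> simplex_ell1" using V(2) by blast
    then show ?thesis using zero[OF *] by (simp add: W_def simplex_ell1_iff)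
  qed (simp add: W_def)
  then have Wnonneg: "\<And>k. 0 \<le> coord (W c) k" and W0: "\<And>k. coord c k = 0 \<Longrightarrow> coord (W c) k = 0"
    and Wnorm: "norm (W c) = norm c" by auto
  have le: "coord (W c) k \<le> coord y k" for k
  proof (cases "coord c k = 0")
    case True
    then show ?thesis using W0 ynonneg by simp
  next
    case False
    then have "k < n" "0 < coord c k" using c0[of k] cnonneg[of k] by (auto simp: not_le[symmetric])
    then show ?thesis using pos[of k] by simp
  qed
  have "W c = y"
  proof (cases "\<forall>i<n. coord c i < 1")
    case True
    show ?thesis
    proof (rule ell1_eqI)
      fix k show "coord (W c) k = coord y k"
        using True less[of k] le[of k] c0[of k] W0[of k] y0[of k] by (cases "k < n") auto
    qed
  next
    case False
    then obtain i where "1 \<le> coord c i" by (auto simp: not_less)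
    then have "1 \<le> norm (W c)" using abs_coord_le_norm[of c i] Wnorm by linarith
    moreover have "norm (W c + (y - W c)) = norm (W c) + norm (y - W c)"
      using Wnonneg le by (intro norm_add_nonneg) auto
    ultimately have "norm (y - W c) \<le> 0" using ynorm by (simp del: norm_le_zero_iff)
    then show ?thesis by simp
  qed
  then have "norm c = 1" using Wnorm ynorm by simp
  then have "c \<in> face {..<n}" "V c = y"
    using cnonneg c0 \<open>W c = y\<close> by (auto simp: face_def simplex_ell1_iff W_def)
  then show thesis by (rule that)
qed

text \<open>
  Cut the point off after \<open>n\<close> coordinates and put the missing mass on the first coordinate.
\<close>

lemma finite_faces_dense:
  assumes y: "y \<in> simplex_ell1" and "e > 0"
  obtains n y' where "y' \<in> face {..<n}" "dist y' y < e"
proof -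
  obtain n0 where n0: "\<And>n. n \<ge> n0 \<Longrightarrow> tail y n < e / 2"
    using order_tendstoD(2)[OF tail_tendsto_0, of "e / 2" y] \<open>e > 0\<close>
    unfolding eventually_sequentially by auto
  define n where "n = Suc n0"
  define z where "z = finvec n (coord y)"
  define d where "d = finvec 1 (\<lambda>_. tail y n)"
  have y': "\<And>k. 0 \<le> coord y k" "norm y = 1" using y by (auto simp: simplex_ell1_iff)
  have "norm z = (\<Sum>k<n. \<bar>coord y k\<bar>)"
    by (subst norm_if_finite_support[of n]) (auto simp: z_def)
  moreover have nd: "norm d = tail y n"
    by (subst norm_if_finite_support[of 1]) (auto simp: d_def tail_nonneg)
  moreover have "norm (z + d) = norm z + norm d"
    using y' by (intro norm_add_nonneg) (auto simp: z_def d_def tail_nonneg)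
  ultimately have "norm (z + d) = 1"
    using norm_eq_sum_tail[of y n] y' by simp
  then have "z + d \<in> face {..<n}"
    using y' by (auto simp: face_def simplex_ell1_iff z_def d_def tail_nonneg n_def)
  moreover have "dist (z + d) y < e"
  proof -
    have "norm (z - y) = tail y n"
      unfolding norm_eq_sum_tail[of "z - y" n] by (simp add: tail_def z_def)
    then have "norm ((z - y) + d) \<le> tail y n + tail y n"
      using norm_triangle_ineq[of "z - y" d] nd by simp
    then show ?thesis using n0[of n] by (simp add: dist_norm n_def algebra_simps)
  qed
  ultimately show thesis by (rule that)
qed

text \<open>
  Move a little towards the point \<open>w\<close> with coordinates \<open>1/2, 1/4, 1/8, \<dots>\<close>, all of them positive.
\<close>

lemma ri_simplex_dense:
  assumes x: "x \<in> simplex_ell1" and "e > 0"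
  obtains x' where "x' \<in> ri_face UNIV" "dist x' x < e"
proof -
  define w where "w = Abs_ell1 (\<lambda>k. (1 / 2) ^ Suc k)"
  have w: "coord w = (\<lambda>k. (1 / 2) ^ Suc k)"
    unfolding w_def
    by (rule Abs_ell1_inverse) (use power_half_series in \<open>simp add: sums_iff\<close>)
  have w_simplex: "w \<in> simplex_ell1"
    using power_half_series by (simp add: simplex_ell1_def w sums_iff)
  define t where "t = min 1 (e / (2 * (norm (w - x) + 1)))"
  have t: "0 < t" "t \<le> 1" using \<open>e > 0\<close> by (auto simp: t_def add_nonneg_pos)
  define x' where "x' = (1 - t) *\<^sub>R x + t *\<^sub>R w"
  have "x' \<in> simplex_ell1"
    unfolding x'_def using t x w_simplex convex_simplex_ell1 by (intro convexD) auto
  moreover have "0 < coord x' k" for k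
    using t x by (auto simp: x'_def w simplex_ell1_iff intro!: add_nonneg_pos mult_nonneg_nonneg)
  ultimately have "x' \<in> ri_face UNIV" by (simp add: ri_face_def face_def)
  moreover have "dist x' x < e"
  proof -
    have "x' - x = t *\<^sub>R (w - x)" by (simp add: x'_def algebra_simps)
    then have "dist x' x = t * norm (w - x)" using t by (simp add: dist_norm)
    also have "\<dots> \<le> e / (2 * (norm (w - x) + 1)) * (norm (w - x) + 1)"
      using t by (intro mult_mono) (auto simp: t_def)
    also have "\<dots> = e / 2"
      using norm_ge_zero[of "w - x"] by (simp add: field_simps add_nonneg_eq_0_iff)
    finally show ?thesis using \<open>e > 0\<close> by simp
  qed
  ultimately show thesis by (rule that)
qed

section \<open>Volterra operators and the stability estimate\<close>

lemma volterra_form_pmult: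
  assumes "volterra_form V f" "x \<in> simplex_ell1"
  shows "V x = x + pmult x (f x)"
  using assms by (intro ell1_eqI) (simp add: volterra_form_def algebra_simps)

lemma suminf_coord_volterra:
  assumes "volterra_form V f" "x \<in> simplex_ell1"
  shows "(\<Sum>k. coord (V x) k) = 1 + (\<Sum>k. coord x k * coord (f x) k)"
  using suminf_add[OF summable_coord summable_coord_mult, of x x "f x"] assms(2)
  by (simp add: volterra_form_pmult[OF assms] simplex_ell1_def)

text \<open>
  Everything below rests on condition (i). Under condition (ii) the continuity of \<open>V\<close> comes from the
  bounded product, the total mass is preserved because the pairing of \<open>x\<close> with \<open>f x\<close> vanishes, and
  the faces are preserved because \<open>1 + f\<^sub>k(x)\<close> is positive on the support of \<open>x\<close>.
\<close>

lemma volterra_type_imp_cond_i: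
  assumes "volterra_type V f"
  shows "volterra_cond_i V"
proof (cases "volterra_cond_i V")
  case False
  then have form: "volterra_form V f" and ii: "volterra_cond_ii f"
    using assms by (auto simp: volterra_type_def)
  have coordV: "coord (V x) k = coord x k * (1 + coord (f x) k)" if "x \<in> simplex_ell1" for x k
    using form that by (simp add: volterra_form_def)
  have "continuous_on simplex_ell1 (\<lambda>x. x + pmult x (f x))"
    using ii by (intro continuous_on_add continuous_on_id
        bounded_bilinear.continuous_on[OF bounded_bilinear_pmult]) (simp add: volterra_cond_ii_def)
  then have "continuous_on simplex_ell1 V"
    using volterra_form_pmult[OF form] by (simp cong: continuous_on_cong)
  moreover have V_simplex: "V x \<in> simplex_ell1" if x: "x \<in> simplex_ell1" for x
  proof -
    have "(\<Sum>k. coord (V x) k) = 1"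
      using suminf_coord_volterra[OF form x] ii x by (simp add: volterra_cond_ii_def)
    moreover have "0 \<le> 1 + coord (f x) k" for k
      using ii x by (simp add: volterra_cond_ii_def add.commute minus_le_iff) (smt (verit))
    then have "0 \<le> coord (V x) k" for k
      using x coordV[OF x] by (simp add: simplex_ell1_def)
    ultimately show ?thesis by (simp add: simplex_ell1_def)
  qed
  moreover have "V x \<in> ri_face \<alpha>" if x: "x \<in> ri_face \<alpha>" for x \<alpha>
  proof -
    have xs: "x \<in> simplex_ell1" using x by (simp add: ri_face_def face_def)
    have "0 < 1 + coord (f x) k" if "k \<in> \<alpha>" for k
      using ii x that unfolding volterra_cond_ii_def by (smt (verit))
    then show ?thesis
      using x V_simplex[OF xs] coordV[OF xs] by (auto simp: ri_face_def face_def)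
  qed
  ultimately show ?thesis by (auto simp: volterra_cond_i_def)
qed

text \<open>
  With \<open>d = a u - b v\<close> one has \<open>a (u - v) = d - (a - b) v\<close> and \<open>b (u - v) = d - (a - b) u\<close>. Adding the
  two and multiplying by \<open>a - b\<close> gives the identity behind the bound; then \<open>\<bar>a - b\<bar> \<le> a + b\<close>.
  If \<open>a = b = 0\<close>, the quotient is zero by convention.
\<close>

lemma volterra_pointwise_bound:
  fixes a b u v :: real
  assumes "0 \<le> a" "0 \<le> b"
  shows "(a - b)\<^sup>2 * (u + v) / (a + b) \<le> 2 * \<bar>a * u - b * v\<bar> - (a - b) * (u - v)"
proof (cases "a + b = 0")
  case True
  then have "a = 0" "b = 0" using assms by auto
  then show ?thesis by simp
next
  case False
  then have s: "a + b > 0" using assms by simp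
  have "(a - b) * (a * u - b * v) \<le> \<bar>a - b\<bar> * \<bar>a * u - b * v\<bar>"
    by (metis abs_ge_self abs_mult)
  also have "\<dots> \<le> (a + b) * \<bar>a * u - b * v\<bar>"
    using assms by (intro mult_right_mono) auto
  finally have "(a - b) * (a * u - b * v) \<le> (a + b) * \<bar>a * u - b * v\<bar>" .
  moreover have "(a - b)\<^sup>2 * (u + v) = 2 * ((a - b) * (a * u - b * v)) - (a - b) * (u - v) * (a + b)"
    by (simp add: power2_eq_square algebra_simps)
  ultimately have "(a - b)\<^sup>2 * (u + v) \<le> (2 * \<bar>a * u - b * v\<bar> - (a - b) * (u - v)) * (a + b)"
    by (simp add: algebra_simps)
  then show ?thesis using s by (simp add: divide_le_eq)
qed

locale dissipative_volterra =
  fixes V f :: "ell1 \<Rightarrow> ell1"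
  assumes form: "volterra_form V f"
    and continuous_V: "continuous_on simplex_ell1 V"
    and V_simplex: "V ` simplex_ell1 \<subseteq> simplex_ell1"
    and V_ri_face: "V ` ri_face \<alpha> \<subseteq> ri_face \<alpha>"
    and dissipative: "\<And>x y. x \<in> simplex_ell1 \<Longrightarrow> y \<in> simplex_ell1 \<Longrightarrow>
           (\<Sum>k. coord x k * coord (f y) k) + (\<Sum>k. coord y k * coord (f x) k) \<le> 0"
begin

lemma coord_V: "x \<in> simplex_ell1 \<Longrightarrow> coord (V x) k = coord x k * (1 + coord (f x) k)"
  using form by (simp add: volterra_form_def)

lemma V_in_simplex: "x \<in> simplex_ell1 \<Longrightarrow> V x \<in> simplex_ell1"
  using V_simplex by blast

text \<open>
  A point lies in the relative interior of the face spanned by its support, and so does its image.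
\<close>

lemma f_gt:
  assumes x: "x \<in> simplex_ell1" and k: "0 < coord x k"
  shows "0 < 1 + coord (f x) k"
proof -
  have "x \<in> ri_face {i. 0 < coord x i}"
    using x by (force simp: ri_face_def face_def simplex_ell1_iff order_less_le)
  then have "V x \<in> ri_face {i. 0 < coord x i}"
    using V_ri_face by blast
  with k have "0 < coord (V x) k" by (simp add: ri_face_def)
  with k show ?thesis by (simp add: coord_V[OF x] zero_less_mult_iff)
qed

lemma coord_V_eq_0_iff: "x \<in> simplex_ell1 \<Longrightarrow> coord (V x) k = 0 \<longleftrightarrow> coord x k = 0"
  using f_gt[of x k] coord_V[of x k] by (force simp: simplex_ell1_iff order_less_le)

lemma pairing_self: "x \<in> simplex_ell1 \<Longrightarrow> (\<Sum>k. coord x k * coord (f x) k) = 0"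
  using suminf_coord_volterra[OF form, of x] V_in_simplex[of x] by (simp add: simplex_ell1_def)

text \<open>
  Expanding the product, the diagonal terms vanish and the mixed terms are those of the hypothesis.
\<close>

lemma pairing_diff_nonneg:
  assumes x: "x \<in> simplex_ell1" and y: "y \<in> simplex_ell1"
  shows "0 \<le> (\<Sum>k. (coord x k - coord y k) * (coord (f x) k - coord (f y) k))"
proof -
  have "(\<Sum>k. (coord x k - coord y k) * (coord (f x) k - coord (f y) k)) =
    (\<Sum>k. (coord x k * coord (f x) k + coord y k * coord (f y) k) -
         (coord x k * coord (f y) k + coord y k * coord (f x) k))"
    by (simp add: algebra_simps)
  also have "\<dots> = ((\<Sum>k. coord x k * coord (f x) k) + (\<Sum>k. coord y k * coord (f y) k)) -
    ((\<Sum>k. coord x k * coord (f y) k) + (\<Sum>k. coord y k * coord (f x) k))"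
    by (intro sums_unique[symmetric] sums_diff sums_add summable_sums summable_coord_mult)
  finally show ?thesis
    using pairing_self x y dissipative[OF x y] by simp
qed

text \<open>
  The weighted squared distance, with weights \<open>(u + v)/(x + y)\<close>, that the stability estimate bounds.
  Its terms vanish where both coordinates do, since division by zero yields zero.
\<close>

definition gap :: "ell1 \<Rightarrow> ell1 \<Rightarrow> nat \<Rightarrow> real" where
  "gap x y k = (coord x k - coord y k)\<^sup>2 *
     ((1 + coord (f x) k) + (1 + coord (f y) k)) / (coord x k + coord y k)"

lemma gap_nonneg:
  assumes x: "x \<in> simplex_ell1" and y: "y \<in> simplex_ell1"
    and support: "coord x k = 0 \<longleftrightarrow> coord y k = 0"
  shows "0 \<le> gap x y k"
proof (cases "coord x k = 0")
  case True
  with support show ?thesis by (simp add: gap_def)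
next
  case False
  then have "0 < coord x k" "0 < coord y k"
    using x y support by (auto simp: simplex_ell1_iff order_less_le)
  then have "0 < 1 + coord (f x) k" "0 < 1 + coord (f y) k" "0 < coord x k + coord y k"
    using f_gt x y by auto
  then show ?thesis
    unfolding gap_def by (intro divide_nonneg_pos mult_nonneg_nonneg) auto
qed

text \<open>
  Equality of the supports guarantees that no summand is negative: off the support the values of
  \<open>f\<close> may be very negative, but there the coordinate differences vanish.
\<close>

lemma gap_sum_le:
  assumes x: "x \<in> simplex_ell1" and y: "y \<in> simplex_ell1"
    and support: "\<And>k. coord x k = 0 \<longleftrightarrow> coord y k = 0"
  shows "summable (gap x y)" "(\<Sum>k. gap x y k) \<le> 2 * norm (V x - V y)"
proof -
  let ?R = "\<lambda>k. 2 * \<bar>coord (V x - V y) k\<bar> - (coord x k - coord y k) * (coord (f x) k - coord (f y) k)"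
  have le: "gap x y k \<le> ?R k" for k
    using volterra_pointwise_bound[of "coord x k" "coord y k" "1 + coord (f x) k" "1 + coord (f y) k"] x y
    by (simp add: gap_def coord_V simplex_ell1_iff)
  have sp: "summable (\<lambda>k. (coord x k - coord y k) * (coord (f x) k - coord (f y) k))"
    using summable_coord_mult[of "x - y" "f x - f y"] by simp
  have sR: "summable ?R"
    by (intro summable_diff summable_mult sp summable_abs_coord)
  show sg: "summable (gap x y)"
    by (rule summable_comparison_test'[OF sR, where N = 0]) (use le gap_nonneg[OF x y support] in auto)
  have "(\<Sum>k. gap x y k) \<le> (\<Sum>k. ?R k)"
    by (rule suminf_le[OF le sg sR])
  also have "\<dots> = 2 * norm (V x - V y) - (\<Sum>k. (coord x k - coord y k) * (coord (f x) k - coord (f y) k))"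
    by (subst suminf_diff[symmetric, OF summable_mult[OF summable_abs_coord] sp])
      (simp only: suminf_mult[OF summable_abs_coord] norm_ell1)
  finally show "(\<Sum>k. gap x y k) \<le> 2 * norm (V x - V y)"
    using pairing_diff_nonneg[OF x y] by simp
qed

section \<open>Injectivity and surjectivity\<close>

lemma inj_on_V: "inj_on V simplex_ell1"
proof (rule inj_onI, rule ell1_eqI)
  fix x y k assume x: "x \<in> simplex_ell1" and y: "y \<in> simplex_ell1" and eq: "V x = V y"
  have support: "coord x i = 0 \<longleftrightarrow> coord y i = 0" for i
    using coord_V_eq_0_iff[OF x] coord_V_eq_0_iff[OF y] eq by metis
  have "(\<Sum>i. gap x y i) = 0"
    using gap_sum_le[OF x y support] eq gap_nonneg[OF x y support]
    by (simp add: suminf_nonneg order_antisym)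
  then have gap0: "gap x y k = 0"
    using suminf_eq_zero_iff[OF gap_sum_le(1)[OF x y support]] gap_nonneg[OF x y support] by simp
  show "coord x k = coord y k"
  proof (cases "coord x k = 0")
    case True
    then show ?thesis using support by simp
  next
    case False
    then have "0 < coord x k" "0 < coord y k"
      using x y support by (auto simp: simplex_ell1_iff order_less_le)
    moreover from this have "0 < 1 + coord (f x) k" "0 < 1 + coord (f y) k"
      using f_gt x y by auto
    ultimately show ?thesis
      using gap0 unfolding gap_def by auto
  qed
qed

text \<open>
  For \<open>k \<ge> K\<close> the factor \<open>u\<^sub>k + v\<^sub>k\<close> is at least \<open>1/2\<close>. With \<open>s = x\<^sub>k + b\<^sub>k\<close>, the arithmetic-geometric mean
  inequality \<open>d \<le> d\<^sup>2/(2 s t) + t s/2\<close> for \<open>d = \<bar>x\<^sub>k - b\<^sub>k\<bar>\<close> then turns the weighted \<open>\<ell>\<^sub>2\<close> bound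
  into an \<open>\<ell>\<^sub>1\<close> bound; summing \<open>t s/2\<close> contributes \<open>t\<close>. The free parameter \<open>t\<close> will be taken
  proportional to the desired accuracy.
\<close>

lemma tail_diff_le:
  assumes x: "x \<in> ri_face UNIV" and b: "b \<in> ri_face UNIV" and "t > 0"
    and K: "\<And>k. K \<le> k \<Longrightarrow> - 1 / 2 \<le> coord (f b) k"
  shows "tail (x - b) K \<le> 2 * norm (V x - V b) / t + t"
proof -
  have pos: "0 < coord x k" "0 < coord b k" for k
    using x b by (auto simp: ri_face_def)
  have xs: "x \<in> simplex_ell1" and bs: "b \<in> simplex_ell1"
    using x b by (auto simp: ri_face_def face_def)
  have support: "coord x k = 0 \<longleftrightarrow> coord b k = 0" for k
    using pos[of k] by simp
  note gap_sum = gap_sum_le[OF xs bs support]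
  let ?R = "\<lambda>k. gap x b k / t + t / 2 * (coord x k + coord b k)"
  have le: "\<bar>coord (x - b) k\<bar> \<le> ?R k" if k: "K \<le> k" for k
  proof -
    define d where "d = \<bar>coord x k - coord b k\<bar>"
    define s where "s = coord x k + coord b k"
    have s: "s > 0" using pos[of k] by (simp add: s_def)
    have "d\<^sup>2 * (1 / 2) / s \<le> gap x b k"
      unfolding gap_def d_def s_def power2_abs
      using K[OF k] f_gt[OF xs pos(1), of k] pos[of k]
      by (intro divide_right_mono mult_left_mono) auto
    then have "d\<^sup>2 / (2 * s) / t \<le> gap x b k / t"
      using \<open>t > 0\<close> by (intro divide_right_mono) simp_all
    then have "d\<^sup>2 / (2 * s) / t + t / 2 * s \<le> ?R k"
      by (simp only: s_def add_le_cancel_right)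
    moreover have "d \<le> d\<^sup>2 / (2 * s) / t + t / 2 * s"
    proof -
      have "0 \<le> (d - t * s)\<^sup>2 / (2 * s * t)" using s \<open>t > 0\<close> by simp
      also have "\<dots> = d\<^sup>2 / (2 * s) / t + t / 2 * s - d"
        using s \<open>t > 0\<close> by (simp add: power2_eq_square field_simps)
      finally show ?thesis by simp
    qed
    ultimately show ?thesis by (simp add: d_def)
  qed
  have nonneg: "0 \<le> ?R k" for k
    using \<open>t > 0\<close> gap_nonneg[OF xs bs support] pos[of k] by simp
  have sR: "summable ?R"
    by (intro summable_add summable_divide summable_mult gap_sum(1) summable_coord)
  have "tail (x - b) K \<le> (\<Sum>k. ?R (k + K))"
    unfolding tail_def by (intro suminf_le summable_tail summable_ignore_initial_segment[OF sR] le) simp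
  also have "\<dots> \<le> (\<Sum>k. ?R k)"
    using suminf_split_initial_segment[OF sR, of K] sum_nonneg[of "{..<K}" ?R] nonneg by simp
  also have "\<dots> = (\<Sum>k. gap x b k) / t + t / 2 * ((\<Sum>k. coord x k) + (\<Sum>k. coord b k))"
    by (intro sums_unique[symmetric] sums_add sums_divide sums_mult summable_sums gap_sum(1) summable_coord)
  also have "\<dots> \<le> 2 * norm (V x - V b) / t + t"
    using gap_sum(2) xs bs \<open>t > 0\<close> by (simp add: simplex_ell1_def divide_right_mono)
  finally show ?thesis .
qed

lemma V_ri_dense:
  assumes y: "y \<in> simplex_ell1" and "e > 0"
  obtains x where "x \<in> ri_face UNIV" "dist (V x) y < e"
proof -
  obtain n y' where y': "y' \<in> face {..<n}" "dist y' y < e / 2"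
    using finite_faces_dense[OF y half_gt_zero[OF \<open>e > 0\<close>]] .
  obtain x0 where x0: "x0 \<in> face {..<n}" "V x0 = y'"
    using surj_on_finite_face[OF continuous_V V_simplex _ y'(1)] coord_V_eq_0_iff by blast
  then have x0s: "x0 \<in> simplex_ell1" by (simp add: face_def)
  obtain d where d: "d > 0" "\<And>x. x \<in> simplex_ell1 \<Longrightarrow> dist x x0 < d \<Longrightarrow> dist (V x) (V x0) < e / 2"
    using continuous_V x0s \<open>e > 0\<close> unfolding continuous_on_iff by (meson half_gt_zero)
  obtain x where x: "x \<in> ri_face UNIV" "dist x x0 < d"
    using ri_simplex_dense[OF x0s d(1)] .
  have "dist (V x) y' < e / 2"
    using d(2)[of x] x x0 by (simp add: ri_face_def face_def)
  then have "dist (V x) y < e"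
    using y'(2) dist_triangle_half_r[of y' "V x" e y] by (simp add: dist_commute)
  with x(1) show thesis by (rule that)
qed

text \<open>
  The reference point \<open>b\<close> is a late member of the sequence itself: it is fixed before \<open>K\<close> is chosen,
  so \<open>K\<close> depends only on the decay of the two summable sequences \<open>f b\<close> and \<open>b\<close>.
\<close>

lemma preimages_tight:
  assumes X: "\<And>m. X m \<in> ri_face UNIV" and lim: "(\<lambda>m. V (X m)) \<longlonglongrightarrow> y" and "e > 0"
  shows "\<exists>K. \<forall>\<^sub>F m in sequentially. tail (X m) K \<le> e"
proof -
  (* 2 * (2 * d) / t = e / 4 for t = e / 4; the parts e / 4, t and the tail of b stay below e. *)
  define d where "d = e\<^sup>2 / 64"
  have "d > 0" using \<open>e > 0\<close> by (simp add: d_def)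
  then obtain N where N: "\<And>m. m \<ge> N \<Longrightarrow> dist (V (X m)) y < d"
    using lim unfolding lim_sequentially by blast
  define b where "b = X N"
  have "coord (f b) \<longlonglongrightarrow> 0"
    using summable_LIMSEQ_zero[OF summable_coord] .
  then have "\<forall>\<^sub>F k in sequentially. - 1 / 2 < coord (f b) k"
    by (rule order_tendstoD(1)) simp
  moreover have "\<forall>\<^sub>F k in sequentially. tail b k < e / 4"
    using \<open>e > 0\<close> by (intro order_tendstoD(2)[OF tail_tendsto_0]) simp
  ultimately have "\<forall>\<^sub>F k in sequentially. - 1 / 2 < coord (f b) k \<and> tail b k < e / 4"
    by (rule eventually_conj)
  then obtain K where K: "\<And>k. k \<ge> K \<Longrightarrow> - 1 / 2 < coord (f b) k" "tail b K < e / 4"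
    unfolding eventually_sequentially by auto
  have "tail (X m) K \<le> e" if "m \<ge> N" for m
  proof -
    have "norm (V (X m) - V b) \<le> 2 * d"
      using dist_triangle2[of "V (X m)" "V b" y] N[OF that] N[of N] by (simp add: b_def dist_norm)
    then have "2 * norm (V (X m) - V b) / (e / 4) \<le> 4 * d / (e / 4)"
      using \<open>e > 0\<close> by (intro divide_right_mono) auto
    also have "\<dots> = e / 4"
      using \<open>e > 0\<close> by (simp add: d_def power2_eq_square)
    finally have "tail (X m - b) K \<le> e / 4 + e / 4"
      using tail_diff_le[of "X m" b "e / 4" K] X K(1) \<open>e > 0\<close> by (force simp: b_def less_imp_le)
    then show ?thesis
      using tail_triangle[of "X m - b" b K] K(2) \<open>e > 0\<close> by simp
  qed
  then show ?thesis unfolding eventually_sequentially by blast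
qed

lemma surj_V:
  assumes y: "y \<in> simplex_ell1"
  shows "y \<in> V ` simplex_ell1"
proof -
  have "\<exists>x. x \<in> ri_face UNIV \<and> dist (V x) y < inverse (real (Suc m))" for m
    using V_ri_dense[OF y, of "inverse (real (Suc m))"] by auto
  then obtain X where X: "\<And>m. X m \<in> ri_face UNIV"
    and close: "\<And>m. dist (V (X m)) y < inverse (real (Suc m))"
    by metis
  have Xs: "X m \<in> simplex_ell1" for m using X by (simp add: ri_face_def face_def)
  have lim: "(\<lambda>m. V (X m)) \<longlonglongrightarrow> y"
    by (rule metric_tendsto_imp_tendsto[OF LIMSEQ_inverse_real_of_nat])
      (use close in \<open>auto intro!: always_eventually less_imp_le simp del: of_nat_Suc\<close>)
  have "norm (X m) \<le> 1" for m using Xs by (simp add: simplex_ell1_iff)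
  then obtain l r where r: "strict_mono r" and l: "(X \<circ> r) \<longlonglongrightarrow> l"
    using tight_imp_convergent_subseq[of X 1] preimages_tight[OF X lim] by blast
  have ls: "l \<in> simplex_ell1"
    using closed_sequentially[OF closed_simplex_ell1 _ l] Xs by simp
  have "(\<lambda>m. V ((X \<circ> r) m)) \<longlonglongrightarrow> V l"
    using Xs by (intro continuous_on_tendsto_compose[OF continuous_V l ls]) simp
  moreover have "(\<lambda>m. V ((X \<circ> r) m)) \<longlonglongrightarrow> y"
    using LIMSEQ_subseq_LIMSEQ[OF lim r] by (simp add: o_def)
  ultimately have "V l = y" by (rule LIMSEQ_unique)
  with ls show ?thesis by blast
qed

end

theorem theorem2p5:
  fixes V f :: "ell1 \<Rightarrow> ell1"
  assumes "volterra_type V f"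
    and "\<And>x y. x \<in> simplex_ell1 \<Longrightarrow> y \<in> simplex_ell1 \<Longrightarrow>
           (\<Sum>k. coord x k * coord (f y) k) + (\<Sum>k. coord y k * coord (f x) k) \<le> 0"
  shows "bij_betw V simplex_ell1 simplex_ell1"
proof -
  interpret dissipative_volterra V f
    using assms volterra_type_imp_cond_i[OF assms(1)]
    by unfold_locales (auto simp: volterra_type_def volterra_cond_i_def)
  show ?thesis
    using inj_on_V V_simplex surj_V by (auto simp: bij_betw_def)
qed

end
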